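(* For any infinite compact spaces $K$ and $L$, the spaces $C_w(K)$ and $C_p(L)$ are not uniformly homeomorphic.
   Context: All topological spaces are assumed to be Tychonoff, so compact spaces are compact Hausdorff. For a compact space $K$, $C(K)$ denotes the Banach space of all real-valued continuous functions on $K$ with the supremum norm. $C_w(K)$ denotes the set $C(K)$ equipped with the weak topology of this Banach space (the weakest topology making all norm-continuous linear functionals on $C(K)$ continuous). $C_p(K)$ denotes the set $C(K)$ equipped with the pointwise topology, i.e. the topology inherited from the product space $\mathbb{R}^K$. Both are topological vector spaces and carry their natural (translation-invariant) uniformities. A uniform homeomorphism is a bijection that is uniformly continuous together with its inverse with respect to these uniformities. *)

theory Defs
  imports "HOL-Analysis.Analysis"
begin

text \<open>
  A compact space \<open>K\<close> is a type of class \<^class>\<open>t2_space\<close> whose universe is compact. Every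
  continuous real function on it is then bounded, so the type of bounded continuous functions
  \<open>K \<Rightarrow>\<^sub>C real\<close> with its supremum norm is the Banach space \<open>C(K)\<close>.
  The weak and the pointwise topology differ from the norm topology carried by the type class
  instance; they are therefore values of type \<open>_ topology\<close> on the same underlying vector space.
\<close>

definition weak_topology :: "'v::real_normed_vector topology"
  where "weak_topology =
    topology_generated_by {\<phi> -` U | (\<phi> :: 'v \<Rightarrow> real) U. bounded_linear \<phi> \<and> open U}"

definition pointwise_topology :: "('a::topological_space \<Rightarrow>\<^sub>C real) topology"
  where "pointwise_topology =
    pullback_topology UNIV apply_bcontfun (product_topology (\<lambda>_. euclideanreal) UNIV)"

text \<open>
  Uniformities are filters on the square, as in class \<^class>\<open>uniform_space\<close>. The entourages of the
  translation-invariant uniformity are the supersets of \<open>{(x, y). x - y \<in> U}\<close>, where \<open>U\<close> is a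
  neighbourhood of \<open>0\<close>.
\<close>

definition translation_uniformity :: "'v::ab_group_add topology \<Rightarrow> ('v \<times> 'v) filter"
  where "translation_uniformity T = filtercomap (\<lambda>(x, y). x - y) (nhdsin T 0)"

definition uniformly_continuous_wrt ::
    "('a \<times> 'a) filter \<Rightarrow> ('b \<times> 'b) filter \<Rightarrow> ('a \<Rightarrow> 'b) \<Rightarrow> bool"
  where "uniformly_continuous_wrt \<U> \<V> f \<longleftrightarrow> (LIM (x, y) \<U>. (f x, f y) :> \<V>)"

definition uniform_homeomorphism ::
    "('a \<times> 'a) filter \<Rightarrow> ('b \<times> 'b) filter \<Rightarrow> ('a \<Rightarrow> 'b) \<Rightarrow> bool"
  where "uniform_homeomorphism \<U> \<V> h \<longleftrightarrow>
    bij h \<and> uniformly_continuous_wrt \<U> \<V> h \<and> uniformly_continuous_wrt \<V> \<U> (inv h)"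

lemma topspace_weak_topology [simp]:
  "topspace (weak_topology :: 'v::real_normed_vector topology) = UNIV"
proof -
  have "(UNIV :: 'v set) \<in> {\<phi> -` U | (\<phi> :: 'v \<Rightarrow> real) U. bounded_linear \<phi> \<and> open U}"
    using bounded_linear_zero by (auto intro!: exI[of _ "\<lambda>_. 0"] exI[of _ UNIV])
  then show ?thesis
    unfolding weak_topology_def topology_generated_by_topspace by blast
qed

lemma topspace_pointwise_topology [simp]: "topspace pointwise_topology = UNIV"
  by (simp add: pointwise_topology_def topspace_pullback_topology)

lemma continuous_map_weak_topology:
  assumes "bounded_linear (\<phi> :: 'v::real_normed_vector \<Rightarrow> real)"
  shows "continuous_map weak_topology euclideanreal \<phi>"
proof -
  have "openin weak_topology (\<phi> -` U)" if "open U" for U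
    unfolding weak_topology_def using assms that by (intro topology_generated_by_Basis) blast
  then show ?thesis
    by (auto simp: continuous_map_def vimage_def)
qed

lemma weak_topology_coarsest:
  fixes T :: "'v::real_normed_vector topology"
  assumes "topspace T = UNIV"
    and "\<And>\<phi> :: 'v \<Rightarrow> real. bounded_linear \<phi> \<Longrightarrow> continuous_map T euclideanreal \<phi>"
    and "openin weak_topology S"
  shows "openin T S"
proof -
  have "generate_topology_on {\<phi> -` U | (\<phi> :: 'v \<Rightarrow> real) U. bounded_linear \<phi> \<and> open U} S"
    using assms(3) by (simp add: weak_topology_def openin_topology_generated_by_iff)
  then show ?thesis
  proof induction
    case (Basis S)
    then show ?case
      using assms(1,2) by (fastforce simp: continuous_map_def vimage_def)
  qed auto
qed

lemma eventually_translation_uniformity: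
  assumes "topspace T = UNIV"
  shows "eventually P (translation_uniformity T) \<longleftrightarrow>
    (\<exists>U. openin T U \<and> 0 \<in> U \<and> (\<forall>x y. x - y \<in> U \<longrightarrow> P (x, y)))"
  unfolding translation_uniformity_def eventually_filtercomap eventually_nhdsin
  using assms by auto

lemma uniformly_continuous_wrt_uniformity:
  "uniformly_continuous_wrt uniformity uniformity f \<longleftrightarrow> uniformly_continuous_on UNIV f"
  by (simp add: uniformly_continuous_wrt_def uniformly_continuous_on_uniformity)

end

theory Submission
  imports Defs
begin

text \<open>
  A bijection that is uniformly continuous in both directions carries bounded sets to bounded sets.
  The weakly bounded subsets of \<open>C(K)\<close> are the norm bounded ones, so countably many of them, the
  balls, are cofinal. No countable family is cofinal among the pointwise bounded subsets of \<open>C(L)\<close>: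
  given pointwise bounds \<open>b\<^sub>n\<close>, take disjoint nonempty open sets \<open>U\<^sub>n\<close> with points \<open>x\<^sub>n \<in> U\<^sub>n\<close>
  and functions \<open>f\<^sub>n\<close> supported in \<open>U\<^sub>n\<close> with \<open>f\<^sub>n(x\<^sub>n) > b\<^sub>n(x\<^sub>n)\<close>. The sequence \<open>f\<^sub>n\<close> is pointwise
  bounded, and no \<open>b\<^sub>n\<close> bounds it.
\<close>

section \<open>Uniform boundedness and weakly bounded sets\<close>

lemma uniform_boundedness_principle:
  fixes F :: "('a::banach \<Rightarrow>\<^sub>L 'b::real_normed_vector) set"
  assumes "\<And>x. bounded ((\<lambda>f. blinfun_apply f x) ` F)"
  shows "bounded F"
proof -
  \<comment> \<open>The sets \<open>A m\<close> are closed, and pointwise boundedness of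
    \<open>F\<close> makes them cover the space. By Baire's theorem one of them contains a ball, so
    \<open>F\<close> is uniformly bounded there.\<close>
  define A where "A m = (\<Inter>f\<in>F. {x. norm (blinfun_apply f x) \<le> real m})" for m :: nat
  have closedA: "closed (A m)" for m
    unfolding A_def by (intro closed_INT ballI closed_Collect_le continuous_intros)
  have "\<exists>m. x \<in> A m" for x
  proof -
    obtain B where B: "\<And>f. f \<in> F \<Longrightarrow> norm (blinfun_apply f x) \<le> B"
      using assms[of x] by (auto simp: bounded_iff)
    obtain m :: nat where "B \<le> real m"
      using real_arch_simple by blast
    then show ?thesis
      unfolding A_def using B by (force intro: order_trans)
  qed
  then have UnA: "\<Union>(range A) = UNIV"
    by blast
  have "\<exists>m. interior (A m) \<noteq> {}"
  proof (rule ccontr)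
    assume *: "\<nexists>m. interior (A m) \<noteq> {}"
    have "Met_TC.mcomplete (TYPE('a))"
      using complete_UNIV by (simp add: mcomplete_iff_complete)
    then have "Met_TC.mtopology interior_of \<Union>(range A) = ({} :: 'a set)"
      by (rule Met_TC.metric_Baire_category_alt) (use * closedA in auto)
    then show False
      by (simp add: UnA)
  qed
  then obtain m x e where e: "e > 0" and ball: "cball x e \<subseteq> A m"
    by (metis ex_in_conv mem_interior_cball)
  have "norm f \<le> 2 * real m / e" if "f \<in> F" for f
  proof (rule norm_blinfun_bound)
    show "norm (blinfun_apply f z) \<le> 2 * real m / e * norm z" for z
    proof (cases "z = 0")
      case False
      \<comment> \<open>Rescaling \<open>z\<close> to length \<open>e\<close> keeps
        \<open>x + y\<close> in the ball. Subtracting the values at \<open>x\<close> moves the bound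
        from the ball around \<open>x\<close> to vectors at the origin, at the cost of a factor
        2.\<close>
      define y where "y = (e / norm z) *\<^sub>R z"
      have "x \<in> A m" "x + y \<in> A m"
        using e False by (auto intro!: subsetD[OF ball] simp: y_def dist_norm)
      then have "norm (blinfun_apply f x) \<le> m" "norm (blinfun_apply f (x + y)) \<le> m"
        using that by (auto simp: A_def)
      moreover have "blinfun_apply f y = blinfun_apply f (x + y) - blinfun_apply f x"
        by (simp add: blinfun.add_right)
      ultimately have "norm (blinfun_apply f y) \<le> 2 * m"
        using norm_triangle_ineq4[of "blinfun_apply f (x + y)" "blinfun_apply f x"] by simp
      then have "e / norm z * norm (blinfun_apply f z) \<le> 2 * m"
        using e by (simp add: y_def blinfun.scaleR_right)
      then show ?thesis
        using e False by (simp add: field_simps)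
    qed simp
  qed (use e in simp)
  then show ?thesis
    by (auto simp: bounded_iff)
qed

text \<open>Each \<open>g\<close> acts on the dual space by evaluation, and the dual is complete, so
  uniform boundedness gives one bound for all \<open>norm (ev g)\<close>. Point evaluations are
  functionals of norm at most 1, and together they recover the supremum norm of
  \<open>g\<close>.\<close>

lemma weakly_bounded_imp_bounded_bcontfun:
  fixes S :: "('a::topological_space \<Rightarrow>\<^sub>C real) set"
  assumes "\<And>\<phi> :: ('a \<Rightarrow>\<^sub>C real) \<Rightarrow> real. bounded_linear \<phi> \<Longrightarrow> bounded (\<phi> ` S)"
  shows "bounded S"
proof -
  define ev :: "('a \<Rightarrow>\<^sub>C real) \<Rightarrow> (('a \<Rightarrow>\<^sub>C real) \<Rightarrow>\<^sub>L real) \<Rightarrow>\<^sub>L real"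
    where "ev g = Blinfun (\<lambda>\<phi>. blinfun_apply \<phi> g)" for g
  have ev: "blinfun_apply (ev g) \<phi> = blinfun_apply \<phi> g" for g \<phi>
    unfolding ev_def by (simp add: bounded_linear_Blinfun_apply blinfun.bounded_linear_left)
  have "bounded (ev ` S)"
  proof (rule uniform_boundedness_principle)
    show "bounded ((\<lambda>f. blinfun_apply f \<phi>) ` ev ` S)" for \<phi>
      using assms[OF blinfun.bounded_linear_right[of \<phi>]] by (simp add: image_image ev)
  qed
  then obtain B where B: "\<And>g. g \<in> S \<Longrightarrow> norm (ev g) \<le> B"
    by (auto simp: bounded_iff)
  have "norm g \<le> B" if g: "g \<in> S" for g
  proof (rule norm_bound)
    fix x
    define \<delta> where "\<delta> = Blinfun (\<lambda>f :: 'a \<Rightarrow>\<^sub>C real. apply_bcontfun f x)"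
    have "bounded_linear (\<lambda>f :: 'a \<Rightarrow>\<^sub>C real. apply_bcontfun f x)"
      by (rule bounded_linear_intro[where K = 1])
        (simp_all add: plus_bcontfun.rep_eq scaleR_bcontfun.rep_eq norm_bounded flip: real_norm_def)
    then have \<delta>: "blinfun_apply \<delta> f = apply_bcontfun f x" for f
      unfolding \<delta>_def by (simp add: bounded_linear_Blinfun_apply)
    have "norm \<delta> \<le> 1"
      by (rule norm_blinfun_bound) (simp_all add: \<delta> norm_bounded flip: real_norm_def)
    have "norm (apply_bcontfun g x) = norm (blinfun_apply (ev g) \<delta>)"
      by (simp add: ev \<delta>)
    also have "\<dots> \<le> norm (ev g) * norm \<delta>"
      by (rule norm_blinfun)
    also have "\<dots> \<le> norm (ev g) * 1"
      by (rule mult_left_mono) (use \<open>norm \<delta> \<le> 1\<close> in auto)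
    finally show "norm (apply_bcontfun g x) \<le> B"
      using B[OF g] by simp
  qed
  then show ?thesis
    by (auto simp: bounded_iff)
qed

section \<open>Neighbourhoods of 0 in the weak and the pointwise topology\<close>

lemma open_if_openin_weak_topology:
  fixes U :: "'v::real_normed_vector set"
  assumes "openin weak_topology U"
  shows "open U"
  using weak_topology_coarsest[of euclidean U] assms
  by (simp add: linear_continuous_on)

lemma openin_pointwise_topology_vimage:
  assumes "open S"
  shows "openin pointwise_topology {f. apply_bcontfun f x \<in> S}"
proof -
  have "openin (product_topology (\<lambda>_. euclideanreal) UNIV) {f. f x \<in> S}"
    using assms openin_continuous_map_preimage
      [OF continuous_map_product_projection[of x UNIV "\<lambda>_. euclideanreal"], of S]
    by simp
  then show ?thesis
    by (auto simp: pointwise_topology_def openin_pullback_topology)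
qed

text \<open>A basic neighbourhood of 0 restricts only finitely many coordinates. On each of these
  \<open>S\<close> is bounded and hence absorbed, and the largest of the finitely many scaling
  factors serves for all.\<close>

lemma pointwise_bounded_absorbed:
  fixes S :: "('a::topological_space \<Rightarrow>\<^sub>C real) set"
  assumes U: "openin pointwise_topology U" "0 \<in> U"
    and S: "\<And>x. bounded ((\<lambda>f. apply_bcontfun f x) ` S)"
  obtains N :: nat where "\<And>f. f \<in> S \<Longrightarrow> f /\<^sub>R Suc N \<in> U"
proof -
  obtain V where V: "openin (product_topology (\<lambda>_. euclideanreal) UNIV) V" "U = apply_bcontfun -` V"
    using U(1) by (auto simp: pointwise_topology_def openin_pullback_topology)
  have "(\<lambda>_. 0) \<in> V"
    using U(2) V(2) by (simp add: zero_bcontfun.rep_eq)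
  from product_topology_open_contains_basis[OF V(1) this]
  obtain X where X: "\<And>x. 0 \<in> X x" "\<And>x. open (X x)" "finite {x. X x \<noteq> UNIV}"
    "(\<Pi>\<^sub>E x\<in>UNIV. X x) \<subseteq> V"
    by (auto simp: PiE_iff)
  \<comment> \<open>The claim covers all \<open>N\<close> from \<open>n\<close> on, so that it
    survives passing to a maximum over coordinates.\<close>
  have "\<exists>n. \<forall>N\<ge>n. \<forall>f\<in>S. apply_bcontfun f x / Suc N \<in> X x" for x
  proof -
    obtain e where e: "e > 0" "ball 0 e \<subseteq> X x"
      using X(1,2) openE by blast
    obtain B where B: "\<And>f. f \<in> S \<Longrightarrow> \<bar>apply_bcontfun f x\<bar> \<le> B"
      using S[of x] by (auto simp: bounded_iff)
    obtain n :: nat where n: "B / e < n"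
      using reals_Archimedean2 by blast
    have "apply_bcontfun f x / Suc N \<in> X x" if "N \<ge> n" "f \<in> S" for N f
    proof -
      have "B < n * e"
        using n e(1) by (simp add: field_simps)
      also have "\<dots> \<le> Suc N * e"
        using that(1) e(1) by (intro mult_right_mono) auto
      finally have "\<bar>apply_bcontfun f x\<bar> < Suc N * e"
        using B[OF that(2)] by linarith
      then have "\<bar>apply_bcontfun f x / Suc N\<bar> < e"
        by (simp add: abs_divide divide_less_eq mult.commute del: of_nat_Suc)
      then show ?thesis
        using e(2) by (auto simp: dist_real_def)
    qed
    then show ?thesis
      by blast
  qed
  then obtain n where n: "\<And>x N f. n x \<le> N \<Longrightarrow> f \<in> S \<Longrightarrow> apply_bcontfun f x / Suc N \<in> X x"
    by metis
  \<comment> \<open>Inserting 0 keeps the maximum meaningful when no coordinate is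
    restricted.\<close>
  define N where "N = Max (insert 0 (n ` {x. X x \<noteq> UNIV}))"
  have "apply_bcontfun f x / Suc N \<in> X x" if "f \<in> S" for f x
  proof (cases "X x = UNIV")
    case False
    then have "n x \<le> N"
      unfolding N_def using X(3) by (intro Max_ge) auto
    then show ?thesis
      using n that by blast
  qed simp
  then have "f /\<^sub>R Suc N \<in> U" if "f \<in> S" for f
    using X(4) that unfolding V(2)
    by (intro vimageI2 subsetD[OF X(4)])
      (auto simp: scaleR_bcontfun.rep_eq divide_inverse mult.commute simp del: of_nat_Suc)
  then show ?thesis
    using that by blast
qed

section \<open>From uniform continuity to bounds on absorbed sets\<close>

lemma uniformly_continuous_wrtD:
  assumes "uniformly_continuous_wrt \<U> \<V> f" "eventually (\<lambda>(u, v). P u v) \<V>"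
  shows "eventually (\<lambda>(x, y). P (f x) (f y)) \<U>"
  using filterlim_iff[THEN iffD1, rule_format, OF assms(1)[unfolded uniformly_continuous_wrt_def] assms(2)]
  by (simp add: case_prod_unfold)

text \<open>Walk from 0 to \<open>a\<close> in \<open>Suc N\<close> equal steps: each difference
  lies in \<open>U\<close>, so each step changes \<phi> by at most 1. Here \<phi> is an arbitrary
  function, since it will be a functional composed with a nonlinear homeomorphism.\<close>

lemma abs_diff_zero_le_steps:
  fixes \<phi> :: "'v::real_vector \<Rightarrow> real"
  assumes step: "\<And>x y. x - y \<in> U \<Longrightarrow> \<bar>\<phi> x - \<phi> y\<bar> \<le> 1" and a: "a /\<^sub>R Suc N \<in> U"
  shows "\<bar>\<phi> a - \<phi> 0\<bar> \<le> Suc N"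
proof -
  define d where "d = a /\<^sub>R Suc N"
  have "\<bar>\<phi> (real k *\<^sub>R d) - \<phi> 0\<bar> \<le> k" for k :: nat
  proof (induction k)
    case (Suc k)
    have "d \<in> U"
      using a by (simp only: d_def)
    then have "\<bar>\<phi> (real (Suc k) *\<^sub>R d) - \<phi> (real k *\<^sub>R d)\<bar> \<le> 1"
      by (intro step) (simp add: scaleR_left_distrib)
    with Suc show ?case
      by simp
  qed simp
  from this[of "Suc N"] show ?thesis
    by (simp add: d_def del: of_nat_Suc)
qed

section \<open>Disjoint open sets and bump functions\<close>

lemma infinite_open_split:
  fixes W :: "'a::t2_space set"
  assumes "open W" "infinite W"
  obtains U W' where "open U" "U \<noteq> {}" "open W'" "infinite W'" "U \<subseteq> W" "W' \<subseteq> W" "U \<inter> W' = {}"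
proof -
  obtain x y where xy: "x \<in> W" "y \<in> W" "x \<noteq> y"
    using assms(2) by (metis finite.emptyI finite.insertI finite_subset insert_iff subsetI)
  obtain A B where AB: "open A" "open B" "x \<in> A" "y \<in> B" "A \<inter> B = {}"
    using hausdorff[OF xy(3)] by blast
  \<comment> \<open>If \<open>B \<inter> W\<close> is infinite, it is kept as the remainder and
    \<open>A \<inter> W\<close> is split off. Otherwise \<open>y\<close> has a finite open
    neighbourhood; removing its other points, a closed set, shows that \<open>y\<close> is isolated,
    and \<open>{y}\<close> is split off.\<close>
  show ?thesis
  proof (cases "infinite (B \<inter> W)")
    case True
    show ?thesis
      by (rule that[of "A \<inter> W" "B \<inter> W"]) (use True AB xy assms in auto)
  next
    case False
    have "open (B \<inter> W - (B \<inter> W - {y}))"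
      using False AB assms by (intro open_Diff finite_imp_closed) auto
    moreover have "B \<inter> W - (B \<inter> W - {y}) = {y}"
      using AB xy by auto
    ultimately have "open {y}"
      by simp
    show ?thesis
      by (rule that[of "{y}" "W - {y}"]) (use \<open>open {y}\<close> assms xy in auto)
  qed
qed

text \<open>Split repeatedly, always keeping an infinite open remainder. The set split off at stage
  \<open>n\<close> misses the next remainder, which contains everything split off later.\<close>

lemma infinite_t2_space_disjoint_open_sequence:
  assumes "infinite (UNIV :: 'a::t2_space set)"
  obtains U :: "nat \<Rightarrow> 'a::t2_space set"
  where "\<And>n. open (U n)" "\<And>n. U n \<noteq> {}" "disjoint_family U"
proof -
  define P where "P = (\<lambda>(_ :: nat) W :: 'a set. open W \<and> infinite W)"
  \<comment> \<open>Dependent choice runs over the remainders alone; the sets split off are chosen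
    afterwards.\<close>
  define Q where "Q = (\<lambda>(_ :: nat) (W :: 'a set) W'. W' \<subseteq> W \<and>
    (\<exists>U. open U \<and> U \<noteq> {} \<and> U \<subseteq> W \<and> U \<inter> W' = {}))"
  have "\<exists>W. P 0 W"
    using assms by (auto simp: P_def intro!: exI[of _ UNIV])
  moreover have "\<exists>W'. P (Suc n) W' \<and> Q n W W'" if "P n W" for n W
    using that infinite_open_split[of W] unfolding P_def Q_def by metis
  ultimately obtain W where W: "\<And>n. Q n (W n) (W (Suc n))"
    using dependent_nat_choice[of P Q] by metis
  then obtain U where U: "\<And>n. open (U n)" "\<And>n. U n \<noteq> {}" "\<And>n. U n \<subseteq> W n" "\<And>n. U n \<inter> W (Suc n) = {}"
    unfolding Q_def by metis
  have "antimono W"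
    using W by (intro decseq_SucI) (auto simp: Q_def)
  then have "U n \<inter> U m = {}" if "m < n" for m n
    using U(3)[of n] U(4)[of m] antimonoD[of W "Suc m" n] that by fastforce
  then have "disjoint_family U"
    unfolding disjoint_family_on_def by (metis Int_commute linorder_neqE_nat)
  with U that show ?thesis
    by blast
qed

text \<open>A compact Hausdorff space is normal, so Urysohn's lemma separates \<open>{x}\<close>
  from the complement of \<open>U\<close>. Compactness also makes the resulting function
  bounded.\<close>

lemma compact_t2_bcontfun_bump:
  fixes U :: "'a::t2_space set"
  assumes "compact (UNIV :: 'a set)" "open U" "x \<in> U"
  obtains f :: "'a \<Rightarrow>\<^sub>C real" where "apply_bcontfun f x = c" "\<And>y. y \<notin> U \<Longrightarrow> apply_bcontfun f y = 0"
proof -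
  have "Hausdorff_space (euclidean :: 'a topology)"
    using hausdorff by (fastforce simp: Hausdorff_space_def disjnt_def)
  then have "normal_space (euclidean :: 'a topology)"
    using assms(1) by (intro compact_Hausdorff_or_regular_imp_normal_space)
      (auto simp: compact_space_def)
  then obtain f where f: "continuous_map euclidean euclideanreal f" "f ` {x} \<subseteq> {c}" "f ` (-U) \<subseteq> {0}"
    by (rule Urysohn_lemma_alt[of euclidean "{x}" "-U" c 0])
      (use assms in \<open>auto simp: disjnt_def closed_def[of "-U"]\<close>)
  have cont: "continuous_on UNIV f"
    using f(1) by simp
  then have "bounded (range f)"
    using assms(1) compact_continuous_image compact_imp_bounded by blast
  then have "f \<in> bcontfun"
    using cont by (simp add: bcontfun_def)
  then show ?thesis
    using f that[of "Bcontfun f"] by (auto simp: Bcontfun_inverse)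
qed

lemma pointwise_unbounded_by_sequence:
  fixes b :: "nat \<Rightarrow> 'a::t2_space \<Rightarrow> real"
  assumes "compact (UNIV :: 'a set)" "infinite (UNIV :: 'a set)"
  obtains f :: "nat \<Rightarrow> 'a \<Rightarrow>\<^sub>C real"
  where "\<And>x. bounded (range (\<lambda>n. apply_bcontfun (f n) x))"
    and "\<And>n. \<exists>x. apply_bcontfun (f n) x > b n x"
proof -
  obtain U :: "nat \<Rightarrow> 'a set"
    where U: "\<And>n. open (U n)" "\<And>n. U n \<noteq> {}" "disjoint_family U"
    using infinite_t2_space_disjoint_open_sequence[OF assms(2)] by blast
  have "\<exists>x. x \<in> U n" for n
    using U(2) by blast
  then obtain x where x: "\<And>n. x n \<in> U n"
    by metis
  have "\<exists>g :: 'a \<Rightarrow>\<^sub>C real. apply_bcontfun g (x n) = b n (x n) + 1 \<and> (\<forall>y. y \<notin> U n \<longrightarrow> apply_bcontfun g y = 0)" for n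
    using compact_t2_bcontfun_bump[OF assms(1) U(1) x] by metis
  then obtain f :: "nat \<Rightarrow> 'a \<Rightarrow>\<^sub>C real" where f: "\<And>n. apply_bcontfun (f n) (x n) = b n (x n) + 1"
    "\<And>n y. y \<notin> U n \<Longrightarrow> apply_bcontfun (f n) y = 0"
    by metis
  show ?thesis
  proof (rule that)
    show "\<exists>y. apply_bcontfun (f n) y > b n y" for n
      using f(1)[of n] by (intro exI[of _ "x n"]) simp
    show "bounded (range (\<lambda>n. apply_bcontfun (f n) y))" for y
    proof -
      \<comment> \<open>By disjointness \<open>y\<close> lies in at most one \<open>U m\<close>; if
        it lies in none, any \<open>m\<close> will do. Hence the sequence takes at most two values
        at \<open>y\<close>.\<close>
      obtain m where m: "\<And>n. n \<noteq> m \<Longrightarrow> y \<notin> U n"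
        using U(3) unfolding disjoint_family_on_def by (metis IntI UNIV_I empty_iff)
      have "apply_bcontfun (f n) y \<in> {0, apply_bcontfun (f m) y}" for n
        using f(2)[OF m, of n] by (cases "n = m") auto
      then have "range (\<lambda>n. apply_bcontfun (f n) y) \<subseteq> {0, apply_bcontfun (f m) y}"
        by blast
      then show ?thesis
        by (meson bounded_subset finite.emptyI finite.insertI finite_imp_bounded)
    qed
  qed
qed

section \<open>Transfer of bounded sets in both directions\<close>

theorem proposition3p1:
  assumes "compact (UNIV :: 'k::t2_space set)" and "infinite (UNIV :: 'k set)"
    and "compact (UNIV :: 'l::t2_space set)" and "infinite (UNIV :: 'l set)"
  shows "\<not> (\<exists>h :: ('k \<Rightarrow>\<^sub>C real) \<Rightarrow> ('l \<Rightarrow>\<^sub>C real).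
    uniform_homeomorphism (translation_uniformity weak_topology)
      (translation_uniformity pointwise_topology) h)"
proof
  assume "\<exists>h :: ('k \<Rightarrow>\<^sub>C real) \<Rightarrow> ('l \<Rightarrow>\<^sub>C real).
    uniform_homeomorphism (translation_uniformity weak_topology)
      (translation_uniformity pointwise_topology) h"
  then obtain h :: "('k \<Rightarrow>\<^sub>C real) \<Rightarrow> ('l \<Rightarrow>\<^sub>C real)" where "bij h"
    and h: "uniformly_continuous_wrt (translation_uniformity weak_topology)
      (translation_uniformity pointwise_topology) h"
    and h': "uniformly_continuous_wrt (translation_uniformity pointwise_topology)
      (translation_uniformity weak_topology) (inv h)"
    by (auto simp: uniform_homeomorphism_def)

  \<comment> \<open>First direction: \<open>h\<close> maps every norm ball to a pointwise bounded
    set. Upper bounds are enough to contradict the sequence chosen below.\<close>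
  have "\<exists>B. \<forall>f. norm f \<le> real n \<longrightarrow> apply_bcontfun (h f) y \<le> B" for n y
  proof -
    have "eventually (\<lambda>(u, v). \<bar>apply_bcontfun u y - apply_bcontfun v y\<bar> \<le> 1)
        (translation_uniformity (pointwise_topology :: ('l \<Rightarrow>\<^sub>C real) topology))"
      unfolding eventually_translation_uniformity[OF topspace_pointwise_topology]
      by (intro exI[of _ "{u. apply_bcontfun u y \<in> ball 0 1}"] conjI openin_pointwise_topology_vimage)
        (auto simp: zero_bcontfun.rep_eq minus_bcontfun.rep_eq dist_real_def)
    then have "eventually (\<lambda>(f, g). \<bar>apply_bcontfun (h f) y - apply_bcontfun (h g) y\<bar> \<le> 1)
        (translation_uniformity weak_topology)"
      by (rule uniformly_continuous_wrtD[OF h])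
    then obtain U where U: "openin weak_topology U" "0 \<in> U"
      "\<And>f g. f - g \<in> U \<Longrightarrow> \<bar>apply_bcontfun (h f) y - apply_bcontfun (h g) y\<bar> \<le> 1"
      by (auto simp: eventually_translation_uniformity)
    obtain e where e: "e > 0" "ball 0 e \<subseteq> U"
      using U(1,2) open_if_openin_weak_topology openE by metis
    \<comment> \<open>With this \<open>N\<close>, dividing any element of the ball of radius
      \<open>n\<close> by \<open>Suc N\<close> brings it into \<open>ball 0 e\<close>, so
      \<open>Suc N\<close> steps reach it from 0.\<close>
    obtain N :: nat where N: "n / e < N"
      using reals_Archimedean2 by blast
    have "apply_bcontfun (h f) y \<le> apply_bcontfun (h 0) y + Suc N" if "norm f \<le> n" for f
    proof -
      have "norm f < Suc N * e"
        using N e(1) that by (simp add: field_simps)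
      then have "norm (f /\<^sub>R Suc N) < e"
        by (simp add: field_simps del: of_nat_Suc)
      then have "f /\<^sub>R Suc N \<in> U"
        using e(2) by (auto simp: dist_norm)
      from abs_diff_zero_le_steps[of U "\<lambda>f. apply_bcontfun (h f) y", OF U(3) this] show ?thesis
        by linarith
    qed
    then show ?thesis
      by blast
  qed
  then obtain b where b: "\<And>n y f. norm f \<le> real n \<Longrightarrow> apply_bcontfun (h f) y \<le> b n y"
    by metis
  obtain f where f: "\<And>x. bounded (range (\<lambda>n. apply_bcontfun (f n) x))"
    and unb: "\<And>n. \<exists>x. apply_bcontfun (f n) x > b n x"
    using pointwise_unbounded_by_sequence[OF assms(3,4)] by metis

  \<comment> \<open>Reverse direction: \<open>range f\<close> is pointwise bounded, so
    \<open>inv h\<close> should carry it to a weakly bounded set, which is then norm bounded. It is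
    tested against one functional at a time.\<close>
  have "bounded (inv h ` range f)"
  proof (rule weakly_bounded_imp_bounded_bcontfun)
    fix \<phi> :: "('k \<Rightarrow>\<^sub>C real) \<Rightarrow> real"
    assume \<phi>: "bounded_linear \<phi>"
    interpret \<phi>: bounded_linear \<phi> by fact
    have "openin weak_topology {u. u \<in> topspace weak_topology \<and> \<phi> u \<in> ball 0 1}"
      by (rule openin_continuous_map_preimage[OF continuous_map_weak_topology[OF \<phi>]]) simp
    then have "eventually (\<lambda>(u, v). \<bar>\<phi> u - \<phi> v\<bar> \<le> 1) (translation_uniformity weak_topology)"
      unfolding eventually_translation_uniformity[OF topspace_weak_topology]
      by (intro exI[of _ "{u. \<phi> u \<in> ball 0 1}"]) (auto simp: \<phi>.zero \<phi>.diff dist_real_def)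
    then have "eventually (\<lambda>(u, v). \<bar>\<phi> (inv h u) - \<phi> (inv h v)\<bar> \<le> 1)
        (translation_uniformity pointwise_topology)"
      by (rule uniformly_continuous_wrtD[OF h'])
    then obtain U where U: "openin pointwise_topology U" "0 \<in> U"
      "\<And>u v. u - v \<in> U \<Longrightarrow> \<bar>\<phi> (inv h u) - \<phi> (inv h v)\<bar> \<le> 1"
      by (auto simp: eventually_translation_uniformity)
    \<comment> \<open>One \<open>N\<close> serves the whole sequence, so the number of steps, and
      with it the bound on \<phi>, does not depend on \<open>u\<close>.\<close>
    obtain N where N: "\<And>u. u \<in> range f \<Longrightarrow> u /\<^sub>R Suc N \<in> U"
      using pointwise_bounded_absorbed[OF U(1,2), of "range f"] f by (auto simp: image_image)
    have "\<bar>\<phi> (inv h u)\<bar> \<le> \<bar>\<phi> (inv h 0)\<bar> + Suc N" if "u \<in> range f" for u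
      using abs_diff_zero_le_steps[of U "\<lambda>u. \<phi> (inv h u)", OF U(3) N[OF that]] by linarith
    then show "bounded (\<phi> ` inv h ` range f)"
      unfolding bounded_iff real_norm_def image_image by blast
  qed
  then obtain B where B: "\<And>n. norm (inv h (f n)) \<le> B"
    by (auto simp: bounded_iff)
  \<comment> \<open>The ball of radius \<open>n\<close> contains the preimages of all
    \<open>f k\<close>, in particular that of \<open>f n\<close>. So \<open>b n\<close> bounds
    \<open>f n\<close> everywhere, which the choice of \<open>f\<close> excludes.\<close>
  obtain n :: nat where "B \<le> n"
    using real_arch_simple by blast
  then have "norm (inv h (f n)) \<le> n"
    using B order_trans by blast
  then have "apply_bcontfun (h (inv h (f n))) y \<le> b n y" for y
    by (rule b)
  then have "apply_bcontfun (f n) y \<le> b n y" for y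
    using \<open>bij h\<close> by (simp add: bij_is_surj surj_f_inv_f)
  with unb[of n] show False
    by (meson not_le)
qed

end
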